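(* Let $n\ge 1$. For every element $f=\sum_{\sigma\in\mathfrak S_n}c_\sigma\sigma\in\mathcal H$ and every $\sigma\in\mathfrak S_n$, $$c_\sigma=\frac1{\sqrt{n!}}\langle\varrho(\sigma)h_{\mathrm{inv}},\widehat Tf\rangle .$$ In particular, for every permutation $\sigma\in\mathfrak S_n$, $$\mathrm{maj}(\sigma)=\frac{n(n-1)}4-\frac12\langle\varrho(\sigma)h_{\mathrm{inv}},h_{\mathrm{maj}}\rangle,$$ $$\mathrm{des}(\sigma)=\frac{n-1}2-\frac12\langle\varrho(\sigma)h_{\mathrm{inv}},h_{\mathrm{des}}\rangle,$$ $$\mathrm{inv}(\sigma)=\frac{n(n-1)}4-\frac12\langle\varrho(\sigma)h_{\mathrm{inv}},h_{\mathrm{inv}}\rangle.$$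
   Context: $\mathfrak S_n$ is the symmetric group on $\{1,\dots,n\}$, with products taken left to right: $(\sigma\tau)(i)=\tau(\sigma(i))$. For $\sigma\in\mathfrak S_n$: $\mathrm{Des}(\sigma)=\{i\in\{1,\dots,n-1\}:\sigma(i)>\sigma(i+1)\}$, $\mathrm{des}(\sigma)=\#\mathrm{Des}(\sigma)$, $\mathrm{maj}(\sigma)=\sum_{i\in\mathrm{Des}(\sigma)}i$, $\mathrm{inv}(\sigma)=\#\{i<j:\sigma(i)>\sigma(j)\}$. $\mathcal M$ is the space of complex $n\times n$ skew-symmetric matrices with the inner product $\langle A,B\rangle=\sum_{i<j}\overline{a_{ij}}\,b_{ij}$ for $A=(a_{ij})$, $B=(b_{ij})$. The representation $\varrho$ of $\mathfrak S_n$ in $\mathcal M$ is by simultaneous permutations of rows and columns: $\varrho(\sigma)(a_{ij})_{i,j}=(a_{\sigma(i)\sigma(j)})_{i,j}$. For $1\le i<j\le n$, $E_{ij}\in\mathcal M$ is the skew-symmetric matrix with $1$ in cell $(i,j)$, $-1$ in cell $(j,i)$, and zeros elsewhere. Put $$h_{\mathrm{des}}=\sum_{k=1}^{n-1}E_{k,k+1},\quad h_{\mathrm{maj}}=\sum_{k=1}^{n-1}kE_{k,k+1},\quad h_{\mathrm{inv}}=\sum_{1\le i<j\le n}E_{ij}.$$ For $1\le i<j\le n$ let $e_{ij}=\frac1{\sqrt{n!}}\sum_{\sigma\in\mathfrak S_n}\varepsilon_{ij}(\sigma)\sigma\in\mathbb C[\mathfrak S_n]$, where $\varepsilon_{ij}(\sigma)=1$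 if $\sigma(i)<\sigma(j)$ and $\varepsilon_{ij}(\sigma)=-1$ if $\sigma(i)>\sigma(j)$. $\mathcal H$ is the linear span of the $e_{ij}$, $1\le i<j\le n$, in $\mathbb C[\mathfrak S_n]$ (the $e_{ij}$ are linearly independent), and $\widehat T:\mathcal H\to\mathcal M$ is the linear map with $\widehat Te_{ij}=E_{ij}$ for $i<j$. *)

theory Defs
  imports Complex_Main "HOL-Library.FuncSet" "HOL-Library.Function_Algebras"
    "HOL-Combinatorics.Permutations"
begin

text \<open>
  The symmetric group on \<open>{1..n}\<close> is the set of \<open>\<sigma> :: nat \<Rightarrow> nat\<close> with \<open>\<sigma> permutes {1..n}\<close>.
  Its group algebra is used only as a vector space: an element \<open>\<Sum> c\<^sub>\<sigma> \<sigma>\<close> is the coefficient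
  function \<open>\<sigma> \<mapsto> c\<^sub>\<sigma>\<close>, which is zero outside the group. An \<open>n \<times> n\<close> matrix is a function of two
  indices in \<open>{1..n}\<close>, which is zero outside that range.
\<close>

definition Des :: "nat \<Rightarrow> (nat \<Rightarrow> nat) \<Rightarrow> nat set" where
  "Des n \<sigma> = {i \<in> {1..n-1}. \<sigma> i > \<sigma> (i + 1)}"

definition des :: "nat \<Rightarrow> (nat \<Rightarrow> nat) \<Rightarrow> nat" where
  "des n \<sigma> = card (Des n \<sigma>)"

definition maj :: "nat \<Rightarrow> (nat \<Rightarrow> nat) \<Rightarrow> nat" where
  "maj n \<sigma> = (\<Sum>i\<in>Des n \<sigma>. i)"

definition index_pairs :: "nat \<Rightarrow> (nat \<times> nat) set" where
  "index_pairs n = {(i, j). 1 \<le> i \<and> i < j \<and> j \<le> n}"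

definition invs :: "nat \<Rightarrow> (nat \<Rightarrow> nat) \<Rightarrow> nat" where
  "invs n \<sigma> = card {(i, j) \<in> index_pairs n. \<sigma> i > \<sigma> j}"

type_synonym cmatrix = "nat \<Rightarrow> nat \<Rightarrow> complex"

definition mat_scale :: "complex \<Rightarrow> cmatrix \<Rightarrow> cmatrix" where
  "mat_scale c A = (\<lambda>i j. c * A i j)"

definition skew_mats :: "nat \<Rightarrow> cmatrix set" where
  "skew_mats n = {A. (\<forall>i j. A i j = - A j i) \<and>
                     (\<forall>i j. i \<notin> {1..n} \<or> j \<notin> {1..n} \<longrightarrow> A i j = 0)}"

definition skew_inner :: "nat \<Rightarrow> cmatrix \<Rightarrow> cmatrix \<Rightarrow> complex" where
  "skew_inner n A B = (\<Sum>(i, j)\<in>index_pairs n. cnj (A i j) * B i j)"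

definition rho :: "(nat \<Rightarrow> nat) \<Rightarrow> cmatrix \<Rightarrow> cmatrix" where
  "rho \<sigma> A = (\<lambda>i j. A (\<sigma> i) (\<sigma> j))"

definition E :: "nat \<Rightarrow> nat \<Rightarrow> cmatrix" where
  "E i j = (\<lambda>k l. if k = i \<and> l = j then 1 else if k = j \<and> l = i then -1 else 0)"

definition h_des :: "nat \<Rightarrow> cmatrix" where
  "h_des n = (\<Sum>k=1..n-1. E k (k + 1))"

definition h_maj :: "nat \<Rightarrow> cmatrix" where
  "h_maj n = (\<Sum>k=1..n-1. mat_scale (of_nat k) (E k (k + 1)))"

definition h_inv :: "nat \<Rightarrow> cmatrix" where
  "h_inv n = (\<Sum>(i, j)\<in>index_pairs n. E i j)"

type_synonym group_alg = "(nat \<Rightarrow> nat) \<Rightarrow> complex"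

definition ga_scale :: "complex \<Rightarrow> group_alg \<Rightarrow> group_alg" where
  "ga_scale c f = (\<lambda>\<sigma>. c * f \<sigma>)"

interpretation ga: vector_space ga_scale
  by unfold_locales (auto simp: ga_scale_def algebra_simps)

definition eps :: "nat \<Rightarrow> nat \<Rightarrow> (nat \<Rightarrow> nat) \<Rightarrow> complex" where
  "eps i j \<sigma> = (if \<sigma> i < \<sigma> j then 1 else -1)"

definition e :: "nat \<Rightarrow> nat \<Rightarrow> nat \<Rightarrow> group_alg" where
  "e n i j = (\<lambda>\<sigma>. if \<sigma> permutes {1..n}
                  then 1 / complex_of_real (sqrt (fact n)) * eps i j \<sigma> else 0)"

definition H :: "nat \<Rightarrow> group_alg set" where
  "H n = ga.span {e n i j | i j. (i, j) \<in> index_pairs n}"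

definition is_T_hat :: "nat \<Rightarrow> (group_alg \<Rightarrow> cmatrix) \<Rightarrow> bool" where
  "is_T_hat n T \<longleftrightarrow>
     T \<in> H n \<rightarrow>\<^sub>E skew_mats n \<and>
     (\<forall>f\<in>H n. \<forall>g\<in>H n. T (f + g) = T f + T g) \<and>
     (\<forall>c. \<forall>f\<in>H n. T (ga_scale c f) = mat_scale c (T f)) \<and>
     (\<forall>(i, j)\<in>index_pairs n. T (e n i j) = E i j)"

text \<open>Existence and uniqueness are proved in \<open>is_T_hat_ex1\<close> below.\<close>

definition T_hat :: "nat \<Rightarrow> group_alg \<Rightarrow> cmatrix" where
  "T_hat n = (THE T. is_T_hat n T)"

lemma sum_fun_apply: "(\<Sum>x\<in>A. F x) y = (\<Sum>x\<in>A. F x y)"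
  by (induction A rule: infinite_finite_induct) auto

lemma finite_index_pairs: "finite (index_pairs n)"
  by (rule finite_subset[of _ "{1..n} \<times> {1..n}"]) (auto simp: index_pairs_def)

lemma exists_separating_perms:
  assumes "(i, j) \<in> index_pairs n"
  obtains \<sigma> \<tau> where "\<sigma> permutes {1..n}" "\<tau> permutes {1..n}"
    "eps i j \<sigma> = 1" "eps i j \<tau> = -1"
    "\<And>k l. (k, l) \<in> index_pairs n \<Longrightarrow> (k, l) \<noteq> (i, j) \<Longrightarrow> eps k l \<sigma> = eps k l \<tau>"
proof -
  define j' where "j' = Transposition.transpose i 1 j"
  define \<sigma> where "\<sigma> = Transposition.transpose j' 2 \<circ> Transposition.transpose i 1"
  define \<tau> where "\<tau> = Transposition.transpose 1 2 \<circ> \<sigma>"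
  have ij: "1 \<le> i" "i < j" "j \<le> n" using assms by (auto simp: index_pairs_def)
  have j': "j' \<in> {1..n}" "j' \<noteq> 1"
    using ij by (auto simp: j'_def Transposition.transpose_def)
  have \<sigma>: "\<sigma> permutes {1..n}" unfolding \<sigma>_def
    using ij j' by (intro permutes_compose permutes_swap_id) auto
  have \<tau>: "\<tau> permutes {1..n}" unfolding \<tau>_def
    using ij by (intro permutes_compose[OF \<sigma>] permutes_swap_id) auto
  have vi: "\<sigma> i = 1" using j' by (auto simp: \<sigma>_def Transposition.transpose_def)
  have vj: "\<sigma> j = 2" by (simp add: \<sigma>_def j'_def)
  have eq: "eps k l \<sigma> = eps k l \<tau>" if kl: "(k, l) \<in> index_pairs n" "(k, l) \<noteq> (i, j)" for k l
  proof -
    have inj: "\<sigma> x = \<sigma> y \<longleftrightarrow> x = y" for x y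
      using permutes_inj[OF \<sigma>] by (auto dest: injD)
    have kl': "1 \<le> k" "k < l" "l \<le> n" using kl by (auto simp: index_pairs_def)
    have "\<sigma> k \<in> {1..n}" "\<sigma> l \<in> {1..n}"
      using permutes_in_image[OF \<sigma>] kl' by auto
    moreover have "\<sigma> k \<noteq> \<sigma> l" using inj kl' by auto
    moreover have "\<sigma> k = 1 \<longleftrightarrow> k = i" "\<sigma> k = 2 \<longleftrightarrow> k = j"
      "\<sigma> l = 1 \<longleftrightarrow> l = i" "\<sigma> l = 2 \<longleftrightarrow> l = j"
      using inj vi vj by metis+
    moreover have "\<not> (k = i \<and> l = j)" "\<not> (k = j \<and> l = i)" using kl kl' ij by auto
    ultimately show ?thesis
      by (auto simp: eps_def \<tau>_def Transposition.transpose_def)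
  qed
  show ?thesis
    by (rule that[OF \<sigma> \<tau> _ _ eq]) (auto simp: eps_def \<tau>_def vi vj)
qed

lemma skew_mats_E: "(i, j) \<in> index_pairs n \<Longrightarrow> E i j \<in> skew_mats n"
  by (auto simp: skew_mats_def E_def index_pairs_def)

lemma is_T_hat_ex1: "\<exists>!T. is_T_hat n T"
proof (rule ex_ex1I)
  have "\<forall>p\<in>index_pairs n. \<exists>st. fst st permutes {1..n} \<and> snd st permutes {1..n} \<and>
     eps (fst p) (snd p) (fst st) = 1 \<and> eps (fst p) (snd p) (snd st) = -1 \<and>
     (\<forall>q\<in>index_pairs n. q \<noteq> p \<longrightarrow>
        eps (fst q) (snd q) (fst st) = eps (fst q) (snd q) (snd st))"
  proof
    fix p assume "p \<in> index_pairs n"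
    then obtain i j where p: "p = (i, j)" "(i, j) \<in> index_pairs n" by (cases p) auto
    obtain \<sigma> \<tau> where *: "\<sigma> permutes {1..n}" "\<tau> permutes {1..n}"
      "eps i j \<sigma> = 1" "eps i j \<tau> = -1"
      and sep: "\<And>k l. (k, l) \<in> index_pairs n \<Longrightarrow> (k, l) \<noteq> (i, j) \<Longrightarrow> eps k l \<sigma> = eps k l \<tau>"
    proof (rule exists_separating_perms[OF p(2)], goal_cases)
      case (1 \<sigma> \<tau>)
      show ?case by (rule 1(1)[OF 1(2-5)]) (rule 1(6))
    qed
    have "eps (fst q) (snd q) \<sigma> = eps (fst q) (snd q) \<tau>"
      if "q \<in> index_pairs n" "q \<noteq> (i, j)" for q
      using sep[of "fst q" "snd q"] that by simp
    with * show "\<exists>st. fst st permutes {1..n} \<and> snd st permutes {1..n} \<and>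
       eps (fst p) (snd p) (fst st) = 1 \<and> eps (fst p) (snd p) (snd st) = -1 \<and>
       (\<forall>q\<in>index_pairs n. q \<noteq> p \<longrightarrow>
          eps (fst q) (snd q) (fst st) = eps (fst q) (snd q) (snd st))"
      unfolding p(1) by (intro exI[of _ "(\<sigma>, \<tau>)"]) simp
  qed
  then obtain st where st: "\<And>p. p \<in> index_pairs n \<Longrightarrow>
     fst (st p) permutes {1..n} \<and> snd (st p) permutes {1..n} \<and>
     eps (fst p) (snd p) (fst (st p)) = 1 \<and> eps (fst p) (snd p) (snd (st p)) = -1 \<and>
     (\<forall>q\<in>index_pairs n. q \<noteq> p \<longrightarrow>
        eps (fst q) (snd q) (fst (st p)) = eps (fst q) (snd q) (snd (st p)))"
    by metis
  define r where "r = complex_of_real (sqrt (fact n))"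
  have r: "r \<noteq> 0" by (simp add: r_def)
  define a :: "nat \<times> nat \<Rightarrow> group_alg \<Rightarrow> complex"
    where "a = (\<lambda>p f. r / 2 * (f (fst (st p)) - f (snd (st p))))"
  define T0 :: "group_alg \<Rightarrow> cmatrix"
    where "T0 = (\<lambda>f. \<Sum>p\<in>index_pairs n. mat_scale (a p f) (E (fst p) (snd p)))"
  have a_e: "a p (e n (fst q) (snd q)) = (if p = q then 1 else 0)"
    if "p \<in> index_pairs n" "q \<in> index_pairs n" for p q
    using st[OF that(1)] that r by (auto simp: a_def e_def simp flip: r_def)
  have T0_apply: "T0 f k l = (\<Sum>p\<in>index_pairs n. a p f * E (fst p) (snd p) k l)" for f k l
    by (simp add: T0_def sum_fun_apply mat_scale_def)
  have T0_add: "T0 (f + g) = T0 f + T0 g" for f g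
    by (intro ext) (simp add: T0_apply a_def algebra_simps add_divide_distrib flip: sum.distrib)
  have T0_scale: "T0 (ga_scale c f) = mat_scale c (T0 f)" for c f
  proof -
    have "a p (ga_scale c f) = c * a p f" for p
      by (simp add: a_def ga_scale_def algebra_simps)
    then show ?thesis
      by (intro ext) (simp add: T0_apply mat_scale_def sum_distrib_left mult.assoc)
  qed
  have T0_e: "T0 (e n i j) = E i j" if "(i, j) \<in> index_pairs n" for i j
  proof (intro ext)
    fix k l
    have "T0 (e n i j) k l =
        (\<Sum>p\<in>index_pairs n. if p = (i, j) then E (fst p) (snd p) k l else 0)"
      unfolding T0_apply by (intro sum.cong) (use a_e[OF _ that] in auto)
    also have "\<dots> = E i j k l" using that finite_index_pairs by (simp add: sum.delta)
    finally show "T0 (e n i j) k l = E i j k l" .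
  qed
  have T0_skew: "T0 f \<in> skew_mats n" for f
  proof -
    have E: "E (fst p) (snd p) k l = - E (fst p) (snd p) l k"
      "k \<notin> {1..n} \<or> l \<notin> {1..n} \<Longrightarrow> E (fst p) (snd p) k l = 0"
      if "p \<in> index_pairs n" for p k l
    proof -
      have "E (fst p) (snd p) \<in> skew_mats n" using that by (intro skew_mats_E) simp
      then show "E (fst p) (snd p) k l = - E (fst p) (snd p) l k"
        "k \<notin> {1..n} \<or> l \<notin> {1..n} \<Longrightarrow> E (fst p) (snd p) k l = 0"
        unfolding skew_mats_def by blast+
    qed
    have "T0 f k l = - T0 f l k" for k l
      unfolding T0_apply sum_negf[symmetric]
      by (intro sum.cong refl) (subst E(1)[of _ k l], assumption, rule mult_minus_right)
    moreover have "T0 f k l = 0" if "k \<notin> {1..n} \<or> l \<notin> {1..n}" for k l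
      unfolding T0_apply using E(2)[OF _ that] by (intro sum.neutral) simp
    ultimately show ?thesis unfolding skew_mats_def by blast
  qed
  have eH: "e n i j \<in> H n" if "(i, j) \<in> index_pairs n" for i j
    unfolding H_def using that by (intro ga.span_base) auto
  have Hadd: "f + g \<in> H n" if "f \<in> H n" "g \<in> H n" for f g
    using that unfolding H_def by (rule ga.span_add)
  have Hscale: "ga_scale c f \<in> H n" if "f \<in> H n" for c f
    using that unfolding H_def by (rule ga.span_scale)
  show "\<exists>T. is_T_hat n T"
    by (rule exI[of _ "restrict T0 (H n)"])
       (auto simp: is_T_hat_def T0_add T0_scale T0_e T0_skew eH Hadd Hscale)
  fix T T' assume T: "is_T_hat n T" and T': "is_T_hat n T'"
  have z: "S 0 = 0" if "is_T_hat n S" for S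
  proof -
    have 0: "0 \<in> H n" unfolding H_def by (rule ga.span_zero)
    then have "S (0 + 0) = S 0 + S 0" using that unfolding is_T_hat_def by blast
    then show ?thesis by simp
  qed
  have "T f = T' f" if "f \<in> H n" for f
  proof -
    have "f \<in> H n \<and> T f = T' f"
      using that unfolding H_def
    proof (induction rule: ga.span_induct_alt)
      case base
      show ?case by (rule conjI[OF ga.span_zero]) (simp only: z[OF T] z[OF T'])
    next
      case (step c x y)
      then obtain i j where x: "x = e n i j" and ij: "(i, j) \<in> index_pairs n" by auto
      have m: "x \<in> H n" "y \<in> H n" "ga_scale c x \<in> H n" "ga_scale c x + y \<in> H n"
        using eH[OF ij] step.IH Hscale Hadd by (auto simp: x H_def)
      have "S (ga_scale c x + y) = mat_scale c (E i j) + S y" if "is_T_hat n S" for S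
      proof -
        have "S (ga_scale c x + y) = S (ga_scale c x) + S y"
          using that m unfolding is_T_hat_def by blast
        moreover have "S (ga_scale c x) = mat_scale c (S x)"
          using that m unfolding is_T_hat_def by blast
        moreover have "S x = E i j"
          using that ij unfolding is_T_hat_def x by blast
        ultimately show ?thesis by simp
      qed
      from this[OF T] this[OF T'] step.IH
      have "T (ga_scale c x + y) = T' (ga_scale c x + y)" by metis
      then show ?case using m(4) unfolding H_def by blast
    qed
    then show ?thesis ..
  qed
  moreover have "T \<in> extensional (H n)" "T' \<in> extensional (H n)"
    using T T' by (auto simp: is_T_hat_def PiE_def)
  ultimately show "T = T'" using extensionalityI[of T "H n" T'] by blast
qed

end

theory Submission
  imports Defs
begin

text \<open>
  For \<open>i < j\<close> the \<open>(i, j)\<close> entry of \<open>\<rho>(\<sigma>) h\<^sub>i\<^sub>n\<^sub>v\<close> is \<open>\<epsilon>\<^sub>i\<^sub>j(\<sigma>)\<close>, so pairing \<open>\<rho>(\<sigma>) h\<^sub>i\<^sub>n\<^sub>v\<close> with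
  \<open>E\<^sub>i\<^sub>j\<close> recovers, up to the factor \<open>\<surd>n!\<close>, the coefficient of \<open>\<sigma>\<close> in \<open>e\<^sub>i\<^sub>j\<close>. By linearity this gives
  the formula on the span. The three statistics follow from \<open>\<epsilon>\<^sub>i\<^sub>j = 1 - 2 [\<sigma>(i) > \<sigma>(j)]\<close>.
\<close>

lemma skew_inner_add: "skew_inner n A (B + C) = skew_inner n A B + skew_inner n A C"
  by (simp add: skew_inner_def case_prod_beta distrib_left sum.distrib)

lemma skew_inner_scale: "skew_inner n A (mat_scale c B) = c * skew_inner n A B"
  by (simp add: skew_inner_def case_prod_beta mat_scale_def sum_distrib_left mult.left_commute)

lemma skew_inner_zero: "skew_inner n A 0 = 0"
  by (simp add: skew_inner_def)

lemma skew_inner_sum: "skew_inner n A (\<Sum>x\<in>X. F x) = (\<Sum>x\<in>X. skew_inner n A (F x))"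
  by (induction X rule: infinite_finite_induct)
     (simp_all only: sum.infinite sum.empty sum.insert not_False_eq_True skew_inner_add skew_inner_zero)

text \<open>The form sums only over cells above the diagonal, so the entry -1 of
  \<open>E i j\<close> in cell (j, i) never contributes. The conjugate is there because the form is
  antilinear in its first argument.\<close>

lemma skew_inner_E:
  assumes "(i, j) \<in> index_pairs n"
  shows "skew_inner n A (E i j) = cnj (A i j)"
proof -
  have "skew_inner n A (E i j) = (\<Sum>p\<in>index_pairs n. if p = (i, j) then cnj (A i j) else 0)"
    unfolding skew_inner_def
    by (intro sum.cong) (use assms in \<open>auto simp: E_def index_pairs_def split: if_splits\<close>)
  then show ?thesis using assms finite_index_pairs by (simp add: sum.delta)
qed

lemma h_inv_apply:
  "h_inv n i j = (if (i, j) \<in> index_pairs n then 1 else if (j, i) \<in> index_pairs n then -1 else 0)"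
proof -
  \<comment> \<open>The nested conditional of \<open>E\<close> splits into two delta terms, since a
    pair with distinct entries cannot equal both (i, j) and (j, i).\<close>
  have "h_inv n i j = (\<Sum>p\<in>index_pairs n.
      (if p = (i, j) then 1 else 0) + (if p = (j, i) then -1 else 0))"
    unfolding h_inv_def sum_fun_apply
  proof (rule sum.cong[OF refl])
    fix p assume "p \<in> index_pairs n"
    then show "(case p of (k, l) \<Rightarrow> E k l) i j =
        (if p = (i, j) then 1 else 0) + (if p = (j, i) then -1 else 0)"
      by (cases p) (auto simp: E_def index_pairs_def)
  qed
  also have "\<dots> = (if (i, j) \<in> index_pairs n then 1 else 0) +
      (if (j, i) \<in> index_pairs n then -1 else 0)"
    by (simp only: sum.distrib sum.delta finite_index_pairs)
  finally show ?thesis by (simp add: index_pairs_def)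
qed

text \<open>On {1..n} the entry of \<open>h_inv n\<close> in cell (k, l) is the sign of l - k.
  Reading it at the images of i and j compares them; these images stay in {1..n} and off the
  diagonal because \<sigma> is a permutation.\<close>

lemma rho_h_inv_apply:
  assumes "\<sigma> permutes {1..n}" "(i, j) \<in> index_pairs n"
  shows "rho \<sigma> (h_inv n) i j = eps i j \<sigma>"
proof -
  have "i \<in> {1..n}" "j \<in> {1..n}" "i \<noteq> j" using assms(2) by (auto simp: index_pairs_def)
  then have "\<sigma> i \<in> {1..n}" "\<sigma> j \<in> {1..n}" "\<sigma> i \<noteq> \<sigma> j"
    using permutes_in_image[OF assms(1)] permutes_inj[OF assms(1)] by (auto dest: injD)
  then show ?thesis by (auto simp: rho_def h_inv_apply eps_def index_pairs_def)
qed

text \<open>The conjugate disappears because the signs are real.\<close>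

lemma skew_inner_rho_h_inv_E:
  assumes "\<sigma> permutes {1..n}" "(i, j) \<in> index_pairs n"
  shows "skew_inner n (rho \<sigma> (h_inv n)) (E i j) = eps i j \<sigma>"
  using assms by (simp add: skew_inner_E rho_h_inv_apply eps_def)

lemma eps_eq_of_bool:
  assumes "\<sigma> permutes {1..n}" "i \<noteq> j"
  shows "eps i j \<sigma> = 1 - 2 * of_bool (\<sigma> i > \<sigma> j)"
proof -
  \<comment> \<open>On a tie \<open>eps\<close> would be -1 while the right side would be 1;
    injectivity excludes this.\<close>
  have "\<sigma> i \<noteq> \<sigma> j" using assms permutes_inj by (auto dest: injD)
  then show ?thesis by (auto simp: eps_def)
qed

lemma is_T_hat_T_hat: "is_T_hat n (T_hat n)"
  unfolding T_hat_def by (rule theI'[OF is_T_hat_ex1])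

lemma coeff_eq_skew_inner_T_hat:
  assumes "f \<in> H n" and \<sigma>: "\<sigma> permutes {1..n}"
  shows "f \<sigma> = 1 / complex_of_real (sqrt (fact n)) *
           skew_inner n (rho \<sigma> (h_inv n)) (T_hat n f)"
proof -
  let ?r = "1 / complex_of_real (sqrt (fact n))" and ?A = "rho \<sigma> (h_inv n)"
  have add: "T_hat n (f + g) = T_hat n f + T_hat n g" if "f \<in> H n" "g \<in> H n" for f g
    using is_T_hat_T_hat[of n] that unfolding is_T_hat_def by blast
  have scale: "T_hat n (ga_scale c f) = mat_scale c (T_hat n f)" if "f \<in> H n" for c f
    using is_T_hat_T_hat[of n] that unfolding is_T_hat_def by blast
  have e: "T_hat n (e n i j) = E i j" if "(i, j) \<in> index_pairs n" for i j
    using is_T_hat_T_hat[of n] that unfolding is_T_hat_def by blast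
  have zero: "T_hat n 0 = 0"
    using add[of 0 0] by (simp add: H_def ga.span_zero)
  \<comment> \<open>Membership in \<open>H n\<close> is carried through the induction because
    \<open>T_hat n\<close> is known to be linear only there.\<close>
  have "f \<in> H n \<and> f \<sigma> = ?r * skew_inner n ?A (T_hat n f)"
    using assms(1) unfolding H_def
  proof (induction rule: ga.span_induct_alt)
    case base
    show ?case
      by (rule conjI[OF ga.span_zero]) (simp only: zero skew_inner_zero, simp)
  next
    case (step c x y)
    then obtain i j where x: "x = e n i j" and ij: "(i, j) \<in> index_pairs n" by auto
    have xH: "x \<in> H n" unfolding H_def using step.hyps by (rule ga.span_base)
    have cxH: "ga_scale c x \<in> H n" using xH unfolding H_def by (rule ga.span_scale)
    have yH: "y \<in> H n" using step.IH by (simp add: H_def)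
    have "skew_inner n ?A (T_hat n (ga_scale c x + y)) =
        c * eps i j \<sigma> + skew_inner n ?A (T_hat n y)"
      by (simp only: add[OF cxH yH] scale[OF xH] e[OF ij, folded x] skew_inner_add
          skew_inner_scale skew_inner_rho_h_inv_E[OF \<sigma> ij])
    moreover have "(ga_scale c x + y) \<sigma> = c * (?r * eps i j \<sigma>) + y \<sigma>"
      using \<sigma> by (simp add: ga_scale_def x e_def)
    moreover have "y \<sigma> = ?r * skew_inner n ?A (T_hat n y)"
      using step.IH by blast
    ultimately have "(ga_scale c x + y) \<sigma> = ?r * skew_inner n ?A (T_hat n (ga_scale c x + y))"
      by (simp only: distrib_left mult.left_commute)
    then show ?case
      using ga.span_add cxH yH unfolding H_def by blast
  qed
  then show ?thesis ..
qed

lemma sum_of_nat_atLeastAtMost_pred: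
  assumes "n \<ge> 1"
  shows "(\<Sum>k=1..n-1. of_nat k :: complex) = of_nat n * (of_nat n - 1) / 2"
  using double_gauss_sum_from_Suc_0[of "n - 1", where 'a = complex] assms
  by (simp add: of_nat_diff field_simps)

text \<open>Going from m to m + 1 adds the m pairs whose larger entry is m + 1. Half of this count
  is the constant term in the formula for inversions.\<close>

lemma card_index_pairs:
  assumes "n \<ge> 1"
  shows "of_nat (card (index_pairs n)) = (of_nat n * (of_nat n - 1) / 2 :: complex)"
  using assms
proof (induction n rule: dec_induct)
  case base
  have "index_pairs 1 = {}" by (auto simp: index_pairs_def)
  then show ?case by simp
next
  case (step m)
  have "index_pairs (Suc m) = index_pairs m \<union> (\<lambda>i. (i, Suc m)) ` {1..m}"
    by (auto simp: index_pairs_def le_Suc_eq)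
  moreover have "index_pairs m \<inter> (\<lambda>i. (i, Suc m)) ` {1..m} = {}"
    by (auto simp: index_pairs_def)
  moreover have "card ((\<lambda>i. (i, Suc m)) ` {1..m}) = m"
    by (subst card_image) (auto simp: inj_on_def)
  ultimately have "card (index_pairs (Suc m)) = card (index_pairs m) + m"
    by (simp add: card_Un_disjoint finite_index_pairs)
  then show ?case using step.IH by (simp add: field_simps)
qed

text \<open>Arbitrary weights treat both descent statistics at once: weight k gives
  \<open>maj\<close>, weight 1 gives \<open>des\<close>. Position k contributes \<open>w k\<close>,
  with its sign flipped exactly at a descent.\<close>

lemma weighted_descents:
  fixes w :: "nat \<Rightarrow> complex"
  assumes "\<sigma> permutes {1..n}"
  shows "skew_inner n (rho \<sigma> (h_inv n)) (\<Sum>k=1..n-1. mat_scale (w k) (E k (k + 1))) =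
    (\<Sum>k=1..n-1. w k) - 2 * (\<Sum>k\<in>Des n \<sigma>. w k)"
proof -
  have "skew_inner n (rho \<sigma> (h_inv n)) (\<Sum>k=1..n-1. mat_scale (w k) (E k (k + 1))) =
      (\<Sum>k=1..n-1. w k * eps k (k + 1) \<sigma>)"
    unfolding skew_inner_sum skew_inner_scale
    by (intro sum.cong refl arg_cong2[of _ _ _ _ "(*)"] skew_inner_rho_h_inv_E assms)
       (auto simp: index_pairs_def)
  also have "\<dots> = (\<Sum>k=1..n-1. w k - 2 * (if \<sigma> k > \<sigma> (k + 1) then w k else 0))"
    using eps_eq_of_bool[OF assms] by (intro sum.cong) auto
  also have "\<dots> = (\<Sum>k=1..n-1. w k) - 2 * (\<Sum>k\<in>Des n \<sigma>. w k)"
    unfolding Des_def by (simp only: sum_subtractf sum_distrib_left[symmetric] sum.inter_filter finite_atLeastAtMost)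
  finally show ?thesis .
qed

text \<open>The pairing is the number of non-inversions minus the number of inversions.\<close>

lemma skew_inner_h_inv:
  assumes "\<sigma> permutes {1..n}"
  shows "skew_inner n (rho \<sigma> (h_inv n)) (h_inv n) =
    of_nat (card (index_pairs n)) - 2 * of_nat (invs n \<sigma>)"
proof -
  have "skew_inner n A (h_inv n) = (\<Sum>(i, j)\<in>index_pairs n. skew_inner n A (E i j))" for A
    by (simp add: h_inv_def skew_inner_sum case_prod_beta)
  also have "(\<Sum>(i, j)\<in>index_pairs n. skew_inner n (rho \<sigma> (h_inv n)) (E i j)) =
      (\<Sum>(i, j)\<in>index_pairs n. eps i j \<sigma>)"
    by (intro sum.cong) (auto intro: skew_inner_rho_h_inv_E[OF assms])
  also have "\<dots> = (\<Sum>p\<in>index_pairs n. 1 - 2 * (if \<sigma> (fst p) > \<sigma> (snd p) then 1 else 0))"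
    using eps_eq_of_bool[OF assms] by (intro sum.cong) (auto simp: index_pairs_def)
  also have "\<dots> = of_nat (card (index_pairs n)) - 2 * of_nat (invs n \<sigma>)"
    unfolding invs_def sum_subtractf sum_distrib_left[symmetric]
    by (auto simp: sum.inter_filter[symmetric] finite_index_pairs intro!: arg_cong[of _ _ card])
  finally show ?thesis .
qed

theorem theorem3:
  fixes n :: nat
  assumes "n \<ge> 1"
  shows "(\<forall>f\<in>H n. \<forall>\<sigma>. \<sigma> permutes {1..n} \<longrightarrow>
            f \<sigma> = 1 / complex_of_real (sqrt (fact n)) * skew_inner n (rho \<sigma> (h_inv n)) (T_hat n f)) \<and>
         (\<forall>\<sigma>. \<sigma> permutes {1..n} \<longrightarrow>
            of_nat (maj n \<sigma>) =
              of_nat n * (of_nat n - 1) / 4 - 1 / 2 * skew_inner n (rho \<sigma> (h_inv n)) (h_maj n) \<and>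
            of_nat (des n \<sigma>) =
              (of_nat n - 1) / 2 - 1 / 2 * skew_inner n (rho \<sigma> (h_inv n)) (h_des n) \<and>
            of_nat (invs n \<sigma>) =
              of_nat n * (of_nat n - 1) / 4 - 1 / 2 * skew_inner n (rho \<sigma> (h_inv n)) (h_inv n))"
proof (intro conjI allI impI ballI)
  fix f \<sigma> assume "f \<in> H n" "\<sigma> permutes {1..n}"
  then show "f \<sigma> = 1 / complex_of_real (sqrt (fact n)) *
      skew_inner n (rho \<sigma> (h_inv n)) (T_hat n f)"
    by (rule coeff_eq_skew_inner_T_hat)
next
  fix \<sigma> :: "nat \<Rightarrow> nat" assume \<sigma>: "\<sigma> permutes {1..n}"
  show "of_nat (maj n \<sigma>) =
      of_nat n * (of_nat n - 1) / 4 - 1 / 2 * skew_inner n (rho \<sigma> (h_inv n)) (h_maj n)"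
    unfolding h_maj_def weighted_descents[OF \<sigma>] sum_of_nat_atLeastAtMost_pred[OF assms]
    by (simp add: maj_def field_simps)
  \<comment> \<open>The scalar 1 brings \<open>h_des n\<close> into the weighted form. The total
    weight is then the truncated difference n - 1, which agrees with the complex one because n is at
    least 1.\<close>
  have "h_des n = (\<Sum>k=1..n-1. mat_scale 1 (E k (k + 1)))"
    by (simp add: h_des_def mat_scale_def)
  then show "of_nat (des n \<sigma>) =
      (of_nat n - 1) / 2 - 1 / 2 * skew_inner n (rho \<sigma> (h_inv n)) (h_des n)"
    using assms by (simp only: weighted_descents[OF \<sigma>]) (simp add: des_def of_nat_diff field_simps)
  show "of_nat (invs n \<sigma>) =
      of_nat n * (of_nat n - 1) / 4 - 1 / 2 * skew_inner n (rho \<sigma> (h_inv n)) (h_inv n)"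
    unfolding skew_inner_h_inv[OF \<sigma>] card_index_pairs[OF assms] by (simp add: field_simps)
qed

end
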